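(* Let $m\le M$ be real numbers, let $x_1,\dots,x_n$ be real numbers with $m\le x_i\le M$ for $i=1,\dots,n$, and let $p_1,\dots,p_n\ge 0$ with $\sum_{i=1}^n p_i=1$. Let $\mu_1'=\sum_{i=1}^n p_i x_i$, $\mu_2=\sum_{i=1}^n p_i(x_i-\mu_1')^2$ and $\mu_4=\sum_{i=1}^n p_i(x_i-\mu_1')^4$. Then $$\mu_4\le \alpha\mu_2+\beta,$$ where $$\alpha=\tfrac34(M-m)^2-2(\mu_1'-m)(M-\mu_1')$$ and $$\beta=(\mu_1'-m)(M-\mu_1')\left(\tfrac14(M-m)^2-(\mu_1'-m)(M-\mu_1')\right).$$
   Context: The numbers $x_i$ are the values of a discrete random variable, taken with probabilities $p_i$; $\mu_1'$ is its mean and $\mu_r$ its $r$-th central moment. *)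

theory Defs
  imports Complex_Main
begin

definition weighted_mean :: "nat \<Rightarrow> (nat \<Rightarrow> real) \<Rightarrow> (nat \<Rightarrow> real) \<Rightarrow> real" where
  "weighted_mean n p x = (\<Sum>i=1..n. p i * x i)"

definition central_moment :: "nat \<Rightarrow> nat \<Rightarrow> (nat \<Rightarrow> real) \<Rightarrow> (nat \<Rightarrow> real) \<Rightarrow> real" where
  "central_moment r n p x = (\<Sum>i=1..n. p i * (x i - weighted_mean n p x) ^ r)"

end

theory Submission
  imports Defs
begin

text \<open>Put \<open>a = \<mu>1 - m\<close>, \<open>b = M - \<mu>1\<close>. On \<open>[-a, b]\<close> the nonnegative quartic
  \<open>(y + a) (b - y) (y + (b - a) / 2)^2\<close> has no cubic term and equals
  \<open>\<alpha> y^2 + c y + \<beta> - y^4\<close> for some \<open>c\<close>. Taking expectations at \<open>y = x - \<mu>1\<close>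
  kills the linear term.\<close>

lemma quartic_le_on_interval:
  fixes a b y :: real
  assumes "- a \<le> y" "y \<le> b"
  shows "y ^ 4 \<le> (3 / 4 * (a + b) ^ 2 - 2 * a * b) * y ^ 2
    + (b - a) * (a * b + (b - a) ^ 2 / 4) * y + a * b * (1 / 4 * (a + b) ^ 2 - a * b)"
    (is "_ \<le> ?r")
proof -
  \<comment> \<open>The double root \<open>(a - b) / 2\<close> makes the four roots sum to zero,
    which is what removes the cubic term.\<close>
  have "?r - y ^ 4 = (y + a) * (b - y) * (y + (b - a) / 2) ^ 2"
    by (simp add: field_simps power2_eq_square power4_eq_xxxx)
  also have "\<dots> \<ge> 0"
    using assms by simp
  finally show ?thesis by simp
qed

theorem theorem2p1:
  fixes m M :: real and n :: nat and x p :: "nat \<Rightarrow> real"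
    and \<mu>1 \<mu>2 \<mu>4 \<alpha> \<beta> :: real
  assumes "m \<le> M"
    and "\<And>i. i \<in> {1..n} \<Longrightarrow> m \<le> x i \<and> x i \<le> M"
    and "\<And>i. i \<in> {1..n} \<Longrightarrow> 0 \<le> p i"
    and "(\<Sum>i=1..n. p i) = 1"
    and "\<mu>1 = weighted_mean n p x"
    and "\<mu>2 = central_moment 2 n p x"
    and "\<mu>4 = central_moment 4 n p x"
    and "\<alpha> = 3 / 4 * (M - m) ^ 2 - 2 * (\<mu>1 - m) * (M - \<mu>1)"
    and "\<beta> = (\<mu>1 - m) * (M - \<mu>1) * (1 / 4 * (M - m) ^ 2 - (\<mu>1 - m) * (M - \<mu>1))"
  shows "\<mu>4 \<le> \<alpha> * \<mu>2 + \<beta>"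
proof -
  \<comment> \<open>The linear coefficient of \<open>quartic_le_on_interval\<close> at
    \<open>a = \<mu>1 - m\<close>, \<open>b = M - \<mu>1\<close>.\<close>
  define c where "c = (M - \<mu>1 - (\<mu>1 - m)) * ((\<mu>1 - m) * (M - \<mu>1) + (M - \<mu>1 - (\<mu>1 - m)) ^ 2 / 4)"
  have centred: "(\<Sum>i=1..n. p i * (x i - \<mu>1)) = 0"
    using assms(4,5)
    by (simp add: weighted_mean_def right_diff_distrib sum_subtractf flip: sum_distrib_right)
  \<comment> \<open>Here \<open>a + b = M - m\<close>, so the other coefficients of the quartic
    bound become exactly \<open>\<alpha>\<close> and \<open>\<beta>\<close>.\<close>
  have pointwise: "(x i - \<mu>1) ^ 4 \<le> \<alpha> * (x i - \<mu>1) ^ 2 + c * (x i - \<mu>1) + \<beta>"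
    if "i \<in> {1..n}" for i
    unfolding c_def using quartic_le_on_interval[of "\<mu>1 - m" "x i - \<mu>1" "M - \<mu>1"] assms(2)[OF that] assms(8,9)
    by simp
  have "\<mu>4 = (\<Sum>i=1..n. p i * (x i - \<mu>1) ^ 4)"
    using assms(5,7) by (simp add: central_moment_def)
  also have "\<dots> \<le> (\<Sum>i=1..n. p i * (\<alpha> * (x i - \<mu>1) ^ 2 + c * (x i - \<mu>1) + \<beta>))"
    using pointwise assms(3) by (intro sum_mono mult_left_mono)
  also have "\<dots> = (\<Sum>i=1..n. \<alpha> * (p i * (x i - \<mu>1) ^ 2) + c * (p i * (x i - \<mu>1)) + \<beta> * p i)"
    by (intro sum.cong refl) (simp only: distrib_left mult_ac)
  also have "\<dots> = \<alpha> * (\<Sum>i=1..n. p i * (x i - \<mu>1) ^ 2) + c * (\<Sum>i=1..n. p i * (x i - \<mu>1))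
      + \<beta> * (\<Sum>i=1..n. p i)"
    by (simp only: sum.distrib sum_distrib_left)
  \<comment> \<open>The first central moment is zero, so the \<open>c\<close> term drops out; total
    weight 1 leaves \<open>\<beta>\<close> as it is.\<close>
  also have "\<dots> = \<alpha> * \<mu>2 + \<beta>"
    unfolding centred assms(4) using assms(5,6) by (simp add: central_moment_def)
  finally show ?thesis .
qed

end
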